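(* Let $X$ be a finite simplicial complex and $0\le k\le\dim X$, and let $\lambda_k(X)=\max\{\|\phi\|_{csy}:\phi\in C^k(X)\}$. Then $$\Bigg(1-20\sqrt{\frac{f_{k-1}(X)}{f_k(X)}}\Bigg)\cdot\frac{f_k(X)}{2}\ \le\ \lambda_k(X)\ \le\ \frac{f_k(X)}{2}.$$
   Context: $f_i(X)$ is the number of $i$-dimensional simplices of $X$ (non-reduced, so $f_{-1}(X)=0$). Cochains have $\mathbb{Z}_2$ coefficients; $\|\phi\|$ is the support size and $\|\phi\|_{csy}=\min_{\psi\in C^{k-1}(X)}\|\phi+d_{k-1}\psi\|$.
   Formalization: The upper bound is stated only for k ≥ 1: at k = 0, with f_{-1}(X) = 0 and no nonzero (-1)-cochains, λ_0(X) = f_0(X) > f_0(X)/2 (for a single point, 1 > 1/2), so the claim fails there; the lower bound is kept for all 0 ≤ k ≤ dim X. *)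

theory Defs
  imports Complex_Main "HOL-Library.Z2"
begin

text \<open>Abstract simplicial complexes. The empty set is not a simplex (non-reduced convention).\<close>

definition finite_simplicial_complex :: "'a set set \<Rightarrow> bool" where
  "finite_simplicial_complex X \<longleftrightarrow>
     finite X \<and> (\<forall>\<sigma>\<in>X. finite \<sigma> \<and> \<sigma> \<noteq> {}) \<and>
     (\<forall>\<sigma>\<in>X. \<forall>\<tau>. \<tau> \<subseteq> \<sigma> \<and> \<tau> \<noteq> {} \<longrightarrow> \<tau> \<in> X)"

text \<open>Dimensions are integers, so that \<open>k - 1\<close> is meaningful for \<open>k = 0\<close>.\<close>

definition simplices :: "'a set set \<Rightarrow> int \<Rightarrow> 'a set set" where
  "simplices X i = {\<sigma> \<in> X. int (card \<sigma>) = i + 1}"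

definition face_number :: "'a set set \<Rightarrow> int \<Rightarrow> nat" where
  "face_number X i = card (simplices X i)"

text \<open>The empty complex has dimension \<open>-1\<close>.\<close>

definition complex_dim :: "'a set set \<Rightarrow> int" where
  "complex_dim X = Max (insert (- 1) ((\<lambda>\<sigma>. int (card \<sigma>) - 1) ` X))"

text \<open>
  A \<open>k\<close>-cochain with coefficients in the two-element field is a function on the
  \<open>k\<close>-simplices; it is extended by zero to a function on all sets. In particular the
  only \<open>(-1)\<close>-cochain is zero.
\<close>

definition cochains :: "'a set set \<Rightarrow> int \<Rightarrow> ('a set \<Rightarrow> bit) set" where
  "cochains X k = {\<phi>. \<forall>\<sigma>. \<sigma> \<notin> simplices X k \<longrightarrow> \<phi> \<sigma> = 0}"

text \<open>\<open>coboundary X k\<close> is the map from \<open>k\<close>-cochains to \<open>(k + 1)\<close>-cochains.\<close>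

definition coboundary :: "'a set set \<Rightarrow> int \<Rightarrow> ('a set \<Rightarrow> bit) \<Rightarrow> 'a set \<Rightarrow> bit" where
  "coboundary X k \<psi> = (\<lambda>\<sigma>. if \<sigma> \<in> simplices X (k + 1) then \<Sum>v\<in>\<sigma>. \<psi> (\<sigma> - {v}) else 0)"

definition cochain_norm :: "('a set \<Rightarrow> bit) \<Rightarrow> nat" where
  "cochain_norm \<phi> = card {\<sigma>. \<phi> \<sigma> \<noteq> 0}"

definition csy_norm :: "'a set set \<Rightarrow> int \<Rightarrow> ('a set \<Rightarrow> bit) \<Rightarrow> nat" where
  "csy_norm X k \<phi> =
     Min ((\<lambda>\<psi>. cochain_norm (\<lambda>\<sigma>. \<phi> \<sigma> + coboundary X (k - 1) \<psi> \<sigma>)) ` cochains X (k - 1))"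

definition max_csy_norm :: "'a set set \<Rightarrow> int \<Rightarrow> nat" where
  "max_csy_norm X k = Max (csy_norm X k ` cochains X k)"

text \<open>The minimum and maximum above range over finite nonempty sets.\<close>

lemma finite_cochains:
  assumes "finite_simplicial_complex X"
  shows "finite (cochains X k)"
proof -
  have fin: "finite (simplices X k)"
    using assms by (auto simp: finite_simplicial_complex_def simplices_def)
  have "cochains X k \<subseteq> (\<lambda>A \<sigma>. if \<sigma> \<in> A then 1 else 0) ` Pow (simplices X k)"
  proof
    fix \<phi> assume \<phi>: "\<phi> \<in> cochains X k"
    have "\<phi> = (\<lambda>\<sigma>. if \<sigma> \<in> {\<sigma>. \<phi> \<sigma> \<noteq> 0} then 1 else 0)"
      by (rule ext) (simp add: bit_not_zero_iff)
    moreover have "{\<sigma>. \<phi> \<sigma> \<noteq> 0} \<in> Pow (simplices X k)"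
      using \<phi> by (auto simp: cochains_def)
    ultimately show "\<phi> \<in> (\<lambda>A \<sigma>. if \<sigma> \<in> A then 1 else 0) ` Pow (simplices X k)"
      by (rule image_eqI)
  qed
  then show ?thesis
    by (rule finite_subset) (simp add: fin)
qed

lemma zero_in_cochains: "(\<lambda>_. 0) \<in> cochains X k"
  by (simp add: cochains_def)

lemma face_number_minus_one:
  assumes "finite_simplicial_complex X"
  shows "face_number X (- 1) = 0"
  using assms by (auto simp: finite_simplicial_complex_def face_number_def simplices_def)

text \<open>
  In degree 0 there is nothing to minimise over, so the maximal cosystolic norm is the
  number of vertices; the bound by half the number of simplices needs \<open>k \<ge> 1\<close>.
\<close>

lemma max_csy_norm_0:
  assumes X: "finite_simplicial_complex X"
  shows "max_csy_norm X 0 = face_number X 0"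
proof -
  have empty: "simplices X (- 1) = {}"
    using X by (auto simp: finite_simplicial_complex_def simplices_def)
  then have C: "cochains X (- 1) = {\<lambda>_. 0}"
    by (auto simp: cochains_def)
  have "coboundary X (- 1) (\<lambda>_. 0) = (\<lambda>_. 0)"
    by (simp add: coboundary_def fun_eq_iff)
  then have csy: "csy_norm X 0 \<phi> = cochain_norm \<phi>" for \<phi>
    by (simp add: csy_norm_def C del: add_bit_eq_xor)
  have fin: "finite (simplices X 0)"
    using X by (auto simp: finite_simplicial_complex_def simplices_def)
  let ?one = "\<lambda>\<sigma>. if \<sigma> \<in> simplices X 0 then (1 :: bit) else 0"
  have "?one \<in> cochains X 0"
    by (simp add: cochains_def)
  moreover have "cochain_norm ?one = face_number X 0"
    by (simp add: cochain_norm_def face_number_def)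
  ultimately have "face_number X 0 \<in> csy_norm X 0 ` cochains X 0"
    unfolding csy by (metis imageI)
  moreover have "csy_norm X 0 \<phi> \<le> face_number X 0" if "\<phi> \<in> cochains X 0" for \<phi>
    unfolding csy cochain_norm_def face_number_def
    using that by (intro card_mono fin) (auto simp: cochains_def)
  ultimately show ?thesis
    unfolding max_csy_norm_def
    by (intro Max_eqI finite_imageI finite_cochains X) auto
qed

end

theory Submission
  imports Defs
begin

text \<open>
  Both bounds come from averaging. For the upper bound, fix \<open>\<phi>\<close>: flipping the value of \<open>\<psi>\<close>
  on one facet of \<open>\<sigma>\<close> flips \<open>(\<phi> + d\<psi>)(\<sigma>)\<close>, so over all \<open>\<psi>\<close> the average of
  \<open>\<parallel>\<phi> + d\<psi>\<parallel>\<close> is \<open>f\<^sub>k / 2\<close>. For the lower bound, a Chernoff estimate shows that for each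
  \<open>\<psi>\<close> only a fraction of at most \<open>exp (-t\<^sup>2 / f\<^sub>k)\<close> of all \<open>\<phi>\<close> satisfies
  \<open>\<parallel>\<phi> + d\<psi>\<parallel> < f\<^sub>k / 2 - t\<close>. With \<open>t\<^sup>2 = 100 f\<^sub>k\<^sub>-\<^sub>1 f\<^sub>k\<close> this beats the union bound over the
  \<open>2\<close> to the \<open>f\<^sub>k\<^sub>-\<^sub>1\<close> cochains \<open>\<psi>\<close>.
\<close>

section \<open>Counting simplices and cochains\<close>

lemma finite_simplices:
  "finite_simplicial_complex X \<Longrightarrow> finite (simplices X k)"
  by (auto simp: finite_simplicial_complex_def simplices_def)

text \<open>The bound \<open>1 \<le> k\<close> keeps the facet nonempty: deleting the vertex of a
  0-simplex leaves the empty set, which is not a simplex here.\<close>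

lemma facet_in_simplices:
  assumes "finite_simplicial_complex X" and "1 \<le> k"
    and "\<sigma> \<in> simplices X k" and "v \<in> \<sigma>"
  shows "\<sigma> - {v} \<in> simplices X (k - 1)"
proof -
  have "finite \<sigma>" "\<sigma> \<in> X" "int (card \<sigma>) = k + 1"
    using assms by (auto simp: finite_simplicial_complex_def simplices_def)
  then have c: "int (card (\<sigma> - {v})) = k"
    using assms by simp
  then have "\<sigma> - {v} \<noteq> {}"
    using assms(2) by (metis card.empty int_ops(1) not_one_le_zero)
  with \<open>\<sigma> \<in> X\<close> have "\<sigma> - {v} \<in> X"
    using assms(1) unfolding finite_simplicial_complex_def by (meson Diff_subset)
  with c show ?thesis
    by (simp add: simplices_def)
qed

text \<open>Supplies the positivity behind the strict inequality on \<open>t\<close> when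
  \<open>max_csy_norm_ge\<close> is applied.\<close>

lemma face_number_facets_pos:
  assumes "finite_simplicial_complex X" and "1 \<le> k" and "face_number X k > 0"
  shows "face_number X (k - 1) > 0"
proof -
  obtain \<sigma> where \<sigma>: "\<sigma> \<in> simplices X k"
    using assms(3) unfolding face_number_def by (metis card_gt_0_iff ex_in_conv)
  then have "\<sigma> \<noteq> {}"
    using assms(1) by (auto simp: finite_simplicial_complex_def simplices_def)
  then obtain v where "v \<in> \<sigma>" by blast
  with \<sigma> have "simplices X (k - 1) \<noteq> {}"
    using facet_in_simplices[OF assms(1,2)] by blast
  then show ?thesis
    using finite_simplices[OF assms(1)] by (simp add: face_number_def card_gt_0_iff)
qed

lemma bij_betw_cochains_support:
  "bij_betw (\<lambda>\<phi>. {\<sigma>. \<phi> \<sigma> \<noteq> 0}) (cochains X k) (Pow (simplices X k))"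
  by (rule bij_betw_byWitness[where f' = "\<lambda>A \<sigma>. of_bool (\<sigma> \<in> A)"])
    (auto simp: cochains_def fun_eq_iff)

lemma card_cochains:
  assumes "finite_simplicial_complex X"
  shows "card (cochains X k) = 2 ^ face_number X k"
  using bij_betw_same_card[OF bij_betw_cochains_support, of X k]
  by (simp add: card_Pow finite_simplices[OF assms] face_number_def)

text \<open>In characteristic 2 a translation is its own inverse.\<close>

lemma bij_betw_cochains_translate:
  assumes "\<psi> \<in> cochains X k"
  shows "bij_betw (\<lambda>\<phi> \<sigma>. \<phi> \<sigma> + \<psi> \<sigma>) (cochains X k) (cochains X k)"
  by (rule bij_betw_byWitness[where f' = "\<lambda>\<phi> \<sigma>. \<phi> \<sigma> + \<psi> \<sigma>"])
    (use assms in \<open>auto simp: cochains_def fun_eq_iff add.assoc simp del: add_bit_eq_xor\<close>)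

lemma coboundary_in_cochains: "coboundary X (k - 1) \<psi> \<in> cochains X k"
  by (simp add: coboundary_def cochains_def)

lemma csy_norm_le:
  assumes "finite_simplicial_complex X" and "\<psi> \<in> cochains X (k - 1)"
  shows "csy_norm X k \<phi> \<le> cochain_norm (\<lambda>\<sigma>. \<phi> \<sigma> + coboundary X (k - 1) \<psi> \<sigma>)"
  unfolding csy_norm_def
  by (rule Min_le[OF finite_imageI[OF finite_cochains[OF assms(1)]] imageI[OF assms(2)]])

lemma csy_norm_attained:
  assumes "finite_simplicial_complex X"
  obtains \<psi> where "\<psi> \<in> cochains X (k - 1)"
    and "csy_norm X k \<phi> = cochain_norm (\<lambda>\<sigma>. \<phi> \<sigma> + coboundary X (k - 1) \<psi> \<sigma>)"
proof -
  have "csy_norm X k \<phi> \<in>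
      (\<lambda>\<psi>. cochain_norm (\<lambda>\<sigma>. \<phi> \<sigma> + coboundary X (k - 1) \<psi> \<sigma>)) ` cochains X (k - 1)"
    unfolding csy_norm_def
    using zero_in_cochains by (intro Min_in finite_imageI finite_cochains assms) auto
  with that show ?thesis by blast
qed

lemma csy_norm_le_max:
  assumes "finite_simplicial_complex X" and "\<phi> \<in> cochains X k"
  shows "csy_norm X k \<phi> \<le> max_csy_norm X k"
  unfolding max_csy_norm_def
  by (rule Max_ge[OF finite_imageI[OF finite_cochains[OF assms(1)]] imageI[OF assms(2)]])

lemma max_csy_norm_attained:
  assumes "finite_simplicial_complex X"
  obtains \<phi> where "\<phi> \<in> cochains X k" and "max_csy_norm X k = csy_norm X k \<phi>"
proof -
  have "max_csy_norm X k \<in> csy_norm X k ` cochains X k"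
    unfolding max_csy_norm_def
    using zero_in_cochains by (intro Max_in finite_imageI finite_cochains assms) auto
  with that show ?thesis by blast
qed

section \<open>Upper bound by averaging over \<open>\<psi>\<close>\<close>

lemma coboundary_flip:
  assumes X: "finite_simplicial_complex X" and \<sigma>: "\<sigma> \<in> simplices X k" and v: "v \<in> \<sigma>"
  shows "coboundary X (k - 1) (\<lambda>\<tau>. \<psi> \<tau> + of_bool (\<tau> = \<sigma> - {v})) \<sigma>
    = coboundary X (k - 1) \<psi> \<sigma> + 1"
proof -
  have fin: "finite \<sigma>"
    using X \<sigma> by (auto simp: finite_simplicial_complex_def simplices_def)
  \<comment> \<open>Deleting different vertices of \<open>\<sigma>\<close> gives different facets,
    so only \<open>u = v\<close> sees the added indicator.\<close>
  have "(\<Sum>u\<in>\<sigma>. of_bool (\<sigma> - {u} = \<sigma> - {v})) = (\<Sum>u\<in>\<sigma>. if u = v then 1 else (0::bit))"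
    using v by (intro sum.cong) auto
  also have "\<dots> = 1" using fin v by simp
  finally show ?thesis
    using \<sigma> by (simp add: coboundary_def sum.distrib del: add_bit_eq_xor)
qed

lemma csy_norm_le_half:
  assumes X: "finite_simplicial_complex X" and k: "1 \<le> k" and \<phi>: "\<phi> \<in> cochains X k"
  shows "2 * csy_norm X k \<phi> \<le> face_number X k"
proof -
  define C where "C = cochains X (k - 1)"
  define S where "S = simplices X k"
  define h where "h \<psi> = (\<lambda>\<sigma>. \<phi> \<sigma> + coboundary X (k - 1) \<psi> \<sigma>)" for \<psi>
  have fin: "finite C" "finite S"
    unfolding C_def S_def using X by (auto intro: finite_cochains finite_simplices)
  have norm: "cochain_norm (h \<psi>) = (\<Sum>\<sigma>\<in>S. of_bool (h \<psi> \<sigma> \<noteq> 0))" for \<psi>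
  proof -
    have "{\<sigma>. h \<psi> \<sigma> \<noteq> 0} \<subseteq> S"
      using \<phi> by (auto simp: h_def S_def cochains_def coboundary_def)
    then have "{\<sigma>. h \<psi> \<sigma> \<noteq> 0} = S \<inter> {\<sigma>. h \<psi> \<sigma> \<noteq> 0}" by blast
    then show ?thesis
      using fin by (simp add: cochain_norm_def)
  qed
  \<comment> \<open>Adding \<open>?e\<close> permutes \<open>C\<close> and exchanges the
    \<open>\<psi>\<close> with \<open>h \<psi> \<sigma> = 0\<close> and those with
    \<open>h \<psi> \<sigma> = 1\<close>.\<close>
  have half: "2 * (\<Sum>\<psi>\<in>C. of_bool (h \<psi> \<sigma> \<noteq> 0)) = card C" if \<sigma>: "\<sigma> \<in> S" for \<sigma>
  proof -
    have "\<sigma> \<noteq> {}"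
      using X \<sigma> by (auto simp: S_def finite_simplicial_complex_def simplices_def)
    then obtain v where v: "v \<in> \<sigma>" by blast
    let ?e = "\<lambda>\<tau>. of_bool (\<tau> = \<sigma> - {v}) :: bit"
    have e: "?e \<in> cochains X (k - 1)"
      using facet_in_simplices[OF X k] \<sigma> v by (auto simp: cochains_def S_def)
    have flip: "h (\<lambda>\<tau>. \<psi> \<tau> + ?e \<tau>) \<sigma> = h \<psi> \<sigma> + 1" for \<psi>
      using coboundary_flip[OF X _ v] \<sigma>
      by (simp add: h_def S_def add.assoc del: add_bit_eq_xor)
    have "(\<Sum>\<psi>\<in>C. of_bool (h \<psi> \<sigma> \<noteq> 0)) = (\<Sum>\<psi>\<in>C. of_bool (h (\<lambda>\<tau>. \<psi> \<tau> + ?e \<tau>) \<sigma> \<noteq> 0) :: nat)"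
      unfolding C_def
      by (rule sum.reindex_bij_betw[OF bij_betw_cochains_translate[OF e], symmetric])
    also have "\<dots> = (\<Sum>\<psi>\<in>C. of_bool (h \<psi> \<sigma> = 0))"
      unfolding flip by (intro sum.cong refl) (auto simp: bit_not_zero_iff)
    finally have "2 * (\<Sum>\<psi>\<in>C. of_bool (h \<psi> \<sigma> \<noteq> 0)) =
        (\<Sum>\<psi>\<in>C. of_bool (h \<psi> \<sigma> \<noteq> 0) + of_bool (h \<psi> \<sigma> = 0) :: nat)"
      by (simp only: sum.distrib mult_2)
    also have "\<dots> = (\<Sum>\<psi>\<in>C. 1)"
      by (intro sum.cong) auto
    finally show ?thesis by simp
  qed
  \<comment> \<open>The minimum over \<open>\<psi>\<close> is at most the average, which is then
    computed one simplex at a time.\<close>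
  have "card C * (2 * csy_norm X k \<phi>) \<le> 2 * (\<Sum>\<psi>\<in>C. cochain_norm (h \<psi>))"
    using sum_bounded_below[of C "csy_norm X k \<phi>" "\<lambda>\<psi>. cochain_norm (h \<psi>)"]
      csy_norm_le[OF X] by (simp add: C_def h_def del: add_bit_eq_xor)
  also have "\<dots> = (\<Sum>\<sigma>\<in>S. 2 * (\<Sum>\<psi>\<in>C. of_bool (h \<psi> \<sigma> \<noteq> 0)))"
    unfolding norm by (subst sum.swap) (simp only: sum_distrib_left)
  also have "\<dots> = (\<Sum>\<sigma>\<in>S. card C)"
    by (intro sum.cong refl half)
  also have "\<dots> = card C * face_number X k"
    by (simp add: face_number_def S_def)
  finally show ?thesis
    using card_cochains[OF X, of "k - 1"] by (simp add: C_def)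
qed

section \<open>Lower bound by exponential moments\<close>

lemma sum_power_card_Pow:
  fixes x :: "'b::comm_semiring_1"
  assumes "finite S"
  shows "(\<Sum>A\<in>Pow S. x ^ card A) = (1 + x) ^ card S"
  using assms
proof (induction S)
  case (insert a S)
  have "(\<Sum>A\<in>Pow (insert a S). x ^ card A)
      = (\<Sum>A\<in>Pow S. x ^ card A) + (\<Sum>A\<in>insert a ` Pow S. x ^ card A)"
    unfolding Pow_insert using insert by (intro sum.union_disjoint) auto
  also have "(\<Sum>A\<in>insert a ` Pow S. x ^ card A) = (\<Sum>A\<in>Pow S. x ^ card (insert a A))"
    using insert by (subst sum.reindex) (auto simp: inj_on_def)
  also have "\<dots> = (\<Sum>A\<in>Pow S. x * x ^ card A)"
  proof (intro sum.cong refl)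
    fix A assume "A \<in> Pow S"
    then have "finite A" "a \<notin> A" using insert finite_subset by auto
    then show "x ^ card (insert a A) = x * x ^ card A" by simp
  qed
  finally show ?case
    using insert by (simp add: sum_distrib_left[symmetric] algebra_simps)
qed simp

text \<open>Up to the factor \<open>2 ^ face_number X k\<close>, this is the moment generating
  function of the norm of a uniformly random cochain: each simplex contributes 1 or \<open>x\<close>
  independently.\<close>

lemma sum_power_cochain_norm:
  fixes x :: "'b::comm_semiring_1"
  assumes "finite_simplicial_complex X"
  shows "(\<Sum>\<phi>\<in>cochains X k. x ^ cochain_norm \<phi>) = (1 + x) ^ face_number X k"
  unfolding cochain_norm_def face_number_def
  using sum.reindex_bij_betw[OF bij_betw_cochains_support, of "\<lambda>A. x ^ card A" X k]
  by (simp add: sum_power_card_Pow finite_simplices[OF assms])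

text \<open>The right-hand side times the Taylor lower bound \<open>1 + y + y\<^sup>2 / 2\<close> of
  \<open>exp y\<close> is \<open>1 + y ^ 4 / 4\<close>, hence at least 1.\<close>

lemma exp_minus_le_quadratic:
  fixes y :: real
  assumes "0 \<le> y"
  shows "exp (- y) \<le> 1 - y + y\<^sup>2 / 2"
proof -
  have "1 + y + y\<^sup>2 / 2 \<le> exp y"
    by (rule exp_lower_Taylor_quadratic[OF assms])
  moreover have pos: "0 < 1 - y + y\<^sup>2 / 2"
    using zero_le_power2[of "y - 1"] by (simp add: power2_eq_square algebra_simps)
  moreover have "(1 - y + y\<^sup>2 / 2) * (1 + y + y\<^sup>2 / 2) = 1 + y ^ 4 / 4"
    by (simp add: algebra_simps power2_eq_square power4_eq_xxxx)
  moreover have "0 \<le> y ^ 4 / 4" by simp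
  ultimately have "1 \<le> (1 - y + y\<^sup>2 / 2) * exp y"
    by (smt (verit) mult_left_mono)
  then show ?thesis
    by (simp add: exp_minus field_simps)
qed

text \<open>The Chernoff factor of a single simplex, from the quadratic bound at
  \<open>y = 2 * l\<close>.\<close>

lemma one_plus_exp_le:
  fixes l :: real
  assumes "0 \<le> l"
  shows "1 + exp (- (2 * l)) \<le> 2 * exp (l\<^sup>2 - l)"
proof -
  have "1 + exp (- (2 * l)) \<le> 2 * (1 + (l\<^sup>2 - l))"
    using exp_minus_le_quadratic[of "2 * l"] assms by (simp add: power2_eq_square algebra_simps)
  also have "\<dots> \<le> 2 * exp (l\<^sup>2 - l)"
    by (intro mult_left_mono exp_ge_add_one_self) simp
  finally show ?thesis .
qed

text \<open>If the bound fails, each \<open>\<phi>\<close> has a \<open>\<psi>\<close> making the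
  norm of \<open>\<phi> + d\<psi>\<close> small. Summing \<open>x ^ norm\<close> over all pairs
  merges Markov's inequality with the union bound and forces
  \<open>t\<^sup>2 \<le> m * n\<close>.\<close>

lemma max_csy_norm_ge:
  assumes X: "finite_simplicial_complex X" and n: "face_number X k > 0"
    and t: "0 \<le> t" "real (face_number X (k - 1)) * real (face_number X k) < t\<^sup>2"
  shows "real (face_number X k) / 2 - t \<le> real (max_csy_norm X k)"
proof (rule ccontr)
  assume less: "\<not> ?thesis"
  define C where "C = cochains X k"
  define B where "B = cochains X (k - 1)"
  define n where "n = face_number X k"
  define m where "m = face_number X (k - 1)"
  \<comment> \<open>The final inequality reads \<open>2 * l * t - n * l\<^sup>2 \<le> m\<close>;
    this \<open>l\<close> maximises its left side.\<close>
  define l where "l = t / n"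
  define x where "x = exp (- (2 * l))"
  define r where "r = exp (- (2 * l) * (n / 2 - t))"
  have npos: "real n > 0" and l: "0 \<le> l"
    using n t by (auto simp: n_def l_def)
  have x: "0 < x" by (simp add: x_def)
  have fin: "finite B" "finite C"
    unfolding B_def C_def by (intro finite_cochains X)+
  have "r \<le> (\<Sum>\<psi>\<in>B. x ^ cochain_norm (\<lambda>\<sigma>. \<phi> \<sigma> + coboundary X (k - 1) \<psi> \<sigma>))"
    if "\<phi> \<in> C" for \<phi>
  proof -
    obtain \<psi> where \<psi>: "\<psi> \<in> B"
      and eq: "csy_norm X k \<phi> = cochain_norm (\<lambda>\<sigma>. \<phi> \<sigma> + coboundary X (k - 1) \<psi> \<sigma>)"
      using csy_norm_attained[OF X, of k \<phi>] unfolding B_def by metis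
    have "real (csy_norm X k \<phi>) \<le> n / 2 - t"
      using less csy_norm_le_max[OF X, of \<phi> k] that by (simp add: C_def n_def)
    then have "r \<le> exp (- (2 * l) * csy_norm X k \<phi>)"
      using l by (simp add: r_def mult_left_mono)
    also have "\<dots> = x ^ csy_norm X k \<phi>"
      by (simp add: x_def exp_of_nat_mult[symmetric] mult.commute)
    also have "\<dots> \<le> (\<Sum>\<psi>\<in>B. x ^ cochain_norm (\<lambda>\<sigma>. \<phi> \<sigma> + coboundary X (k - 1) \<psi> \<sigma>))"
      unfolding eq using \<psi> fin x by (intro member_le_sum) auto
    finally show ?thesis .
  qed
  then have "card C * r \<le>
      (\<Sum>\<phi>\<in>C. \<Sum>\<psi>\<in>B. x ^ cochain_norm (\<lambda>\<sigma>. \<phi> \<sigma> + coboundary X (k - 1) \<psi> \<sigma>))"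
    by (rule sum_bounded_below)
  also have "\<dots> = (\<Sum>\<psi>\<in>B. \<Sum>\<phi>\<in>C. x ^ cochain_norm (\<lambda>\<sigma>. \<phi> \<sigma> + coboundary X (k - 1) \<psi> \<sigma>))"
    by (rule sum.swap)
  \<comment> \<open>Translation by the coboundary of \<open>\<psi>\<close> permutes
    \<open>C\<close>, so the inner sum does not depend on \<open>\<psi>\<close>.\<close>
  also have "\<dots> = (\<Sum>\<psi>\<in>B. (1 + x) ^ n)"
    unfolding C_def n_def sum_power_cochain_norm[OF X, symmetric]
    by (intro sum.cong refl sum.reindex_bij_betw bij_betw_cochains_translate
        coboundary_in_cochains)
  also have "\<dots> = 2 ^ m * (1 + x) ^ n"
    by (simp add: B_def m_def card_cochains[OF X])
  also have "\<dots> \<le> exp m * (2 * exp (l\<^sup>2 - l)) ^ n"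
  proof (intro mult_mono power_mono)
    \<comment> \<open>Only \<open>2 \<le> exp 1\<close> is used, so that the number of
      \<open>\<psi>\<close> adds just \<open>m\<close> to the exponent.\<close>
    show "2 ^ m \<le> exp (real m)"
      using power_mono[of 2 "exp 1 :: real" m] exp_ge_add_one_self[of "1::real"]
      by (simp add: exp_of_nat_mult[symmetric])
  qed (use x l one_plus_exp_le in \<open>auto simp: x_def\<close>)
  finally have "2 ^ n * r \<le> 2 ^ n * exp (m + n * (l\<^sup>2 - l))"
    by (simp add: C_def n_def card_cochains[OF X] power_mult_distrib exp_add
        exp_of_nat_mult mult_ac)
  then have "- (2 * l) * (n / 2 - t) \<le> m + n * (l\<^sup>2 - l)"
    by (simp add: r_def)
  moreover have "n * l = t"
    using npos by (simp add: l_def)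
  then have "n * l\<^sup>2 = l * t"
    by (simp add: power2_eq_square mult_ac)
  ultimately have "l * t \<le> m"
    by (simp add: algebra_simps)
  then have "t\<^sup>2 \<le> m * n"
    using npos by (simp add: l_def field_simps power2_eq_square)
  with t show False by (simp add: m_def n_def)
qed

theorem theorem5p1:
  fixes X :: "'a set set" and k :: int
  assumes "finite_simplicial_complex X"
    and "0 \<le> k" and "k \<le> complex_dim X"
  shows "(1 - 20 * sqrt (real (face_number X (k - 1)) / real (face_number X k)))
           * (real (face_number X k) / 2) \<le> real (max_csy_norm X k)
       \<and> (1 \<le> k \<longrightarrow> real (max_csy_norm X k) \<le> real (face_number X k) / 2)"
proof (intro conjI impI)
  define n where "n = real (face_number X k)"
  define m where "m = real (face_number X (k - 1))"
  have "(1 - 20 * sqrt (m / n)) * (n / 2) \<le> real (max_csy_norm X k)"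
  \<comment> \<open>For \<open>k = 0\<close> we have \<open>m = 0\<close>, and the maximum is
    \<open>n\<close>, which exceeds \<open>n / 2\<close> or equals it at 0. For \<open>n = 0\<close>
    the left side vanishes.\<close>
  proof (cases "k = 0 \<or> n = 0")
    case True
    then show ?thesis
      using max_csy_norm_0[OF assms(1)] face_number_minus_one[OF assms(1)]
      by (auto simp: n_def m_def)
  next
    case False
    then have k: "1 \<le> k" and n: "face_number X k > 0"
      using assms(2) by (auto simp: n_def)
    have m: "m > 0" and n': "n > 0"
      using face_number_facets_pos[OF assms(1) k n] n by (auto simp: m_def n_def)
    \<comment> \<open>This is the error term \<open>20 * sqrt (m / n) * (n / 2)\<close>; its square
      \<open>100 * m * n\<close> is larger than \<open>m * n\<close> since both factors are
      positive.\<close>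
    let ?t = "10 * sqrt (m * n)"
    have "(1 - 20 * sqrt (m / n)) * (n / 2) = n / 2 - 10 * (sqrt (m / n) * n)"
      by (simp add: algebra_simps)
    also have "sqrt (m / n) * n = sqrt (m * n)"
      using n' by (simp add: real_sqrt_divide real_sqrt_mult real_div_sqrt field_simps)
    also have "n / 2 - ?t \<le> real (max_csy_norm X k)"
      unfolding n_def m_def using m n'
      by (intro max_csy_norm_ge assms(1) n) (auto simp: power_mult_distrib n_def m_def)
    finally show ?thesis .
  qed
  then show "(1 - 20 * sqrt (real (face_number X (k - 1)) / real (face_number X k)))
           * (real (face_number X k) / 2) \<le> real (max_csy_norm X k)"
    by (simp add: n_def m_def)
next
  assume k: "1 \<le> k"
  obtain \<phi> where "\<phi> \<in> cochains X k" "max_csy_norm X k = csy_norm X k \<phi>"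
    using max_csy_norm_attained[OF assms(1)] by blast
  with csy_norm_le_half[OF assms(1) k] show "real (max_csy_norm X k) \<le> real (face_number X k) / 2"
    by fastforce
qed

end
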